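(* Let $n,r\in\mathbb{N}$, $\mathbb{M}\subseteq\mathbb{N}$, and let $\mathcal{C}(n,\mathbb{M})$ be a nonempty circle of partition with an axis $\mathbb{L}_{[x],[n-x]}$ (possibly degenerate, i.e. $x=n-x$) such that $x+r\in\mathbb{M}$. If the base set $\mathbb{M}$ is infinite and there exists a nonempty circle of partition $\mathcal{C}(n_0,\mathbb{M})$, then there exist infinitely many positive integers $n>n_0$ with $\mathcal{C}(n,\mathbb{M})$ nonempty.
   Context: $\mathbb{N}$ is the set of positive integers. For $\mathbb{M}\subseteq\mathbb{N}$ and $n\in\mathbb{N}$, the circle of partition is $\mathcal{C}(n,\mathbb{M})=\{[x]: x,y\in\mathbb{M},\ x+y=n\}$; points $[x]$ are identified by their weight $x$. An axis $\mathbb{L}_{[x],[y]}$ of $\mathcal{C}(n,\mathbb{M})$ is an unordered pair of points $[x],[y]\in\mathcal{C}(n,\mathbb{M})$ with $x+y=n$; it is degenerate if $x=y=n/2$. *)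

theory Defs
  imports Main
begin

text \<open>
  The positive integers are the set \<open>{0<..} :: nat set\<close>; positivity of base sets and
  generators is assumed where these are used. A point \<open>[x]\<close> is represented by its weight \<open>x\<close>.
\<close>

definition circle_of_partition :: "nat \<Rightarrow> nat set \<Rightarrow> nat set" where
  "circle_of_partition n M = {x. \<exists>y. x \<in> M \<and> y \<in> M \<and> x + y = n}"

text \<open>
  An axis is an unordered pair of points, represented by the set of its points, so that a
  degenerate axis is a singleton.
\<close>

definition axes :: "nat \<Rightarrow> nat set \<Rightarrow> nat set set" where
  "axes n M = {{x, y} | x y.
     x \<in> circle_of_partition n M \<and> y \<in> circle_of_partition n M \<and> x + y = n}"

end

theory Submission
  imports Defs
begin

text \<open>
  Every \<open>a \<in> M\<close> carries the degenerate axis of the circle of partition generated by \<open>2 * a\<close>, so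
  that circle is nonempty. Doubling is injective, hence an infinite base set yields infinitely many
  generators of nonempty circles; discarding those up to a given bound removes only finitely many.
\<close>

lemma infinite_nonempty_circles_above:
  fixes k :: nat
  assumes "infinite M"
  shows "infinite {m. m > k \<and> circle_of_partition m M \<noteq> {}}"
proof -
  have "infinite (M - {..k})"
    using assms by (simp add: Diff_infinite_finite)
  then have "infinite ((\<lambda>a. a + a) ` (M - {..k}))"
    by (subst finite_image_iff) (auto simp: inj_on_def)
  moreover have "(\<lambda>a. a + a) ` (M - {..k}) \<subseteq> {m. m > k \<and> circle_of_partition m M \<noteq> {}}"
    by (auto simp: circle_of_partition_def)
  ultimately show ?thesis
    by (rule infinite_super[rotated])
qed

theorem corollary2p21:
  fixes n r x n0 :: nat and M :: "nat set"
  assumes "n > 0" and "r > 0" and "M \<subseteq> {0<..}"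
    and "circle_of_partition n M \<noteq> {}"
    and "{x, n - x} \<in> axes n M"
    and "x + r \<in> M"
    and "infinite M"
    and "n0 > 0" and "circle_of_partition n0 M \<noteq> {}"
  shows "infinite {m. m > n0 \<and> circle_of_partition m M \<noteq> {}}"
  using \<open>infinite M\<close> by (rule infinite_nonempty_circles_above)

end
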